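(* Consider the online vertex-weighted stochastic matching problem with independent (not necessarily identically distributed) arrivals, as described in the context. Let the fractional algorithm choose, upon arrival of $v_j$ with realized types $\mathbf{t}_{\le j}$, \[ x_{u,j}(\mathbf{t}_{\le j}) = \tfrac12 \Pr_{\tilde{\mathbf{t}}_{-j}}\big[(u,v_j)\in \mathsf{OPT}(t_j,\tilde{\mathbf{t}}_{-j})\big] + \tfrac12 \Pr_{\tilde{\mathbf{t}}_{>j}}\big[(u,v_j)\in \mathsf{OPT}(\mathbf{t}_{\le j},\tilde{\mathbf{t}}_{>j})\big] \] for every $u\in L$, where $\tilde{\mathbf{t}}_{-j}$ (resp. $\tilde{\mathbf{t}}_{>j}$) is a fresh independent sample of the types of all vertices other than $v_j$ (resp. of $v_{j+1},\dots,v_n$). Then this fractional algorithm is $0.646$-competitive, and the integral algorithm obtained by rounding it with the OCS is $0.634$-competitive.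
   Context: Problem: there is a finite set $L$ of offline vertices, each $u\in L$ with weight $w_u\ge 0$, and $n$ online vertices $v_1,\dots,v_n$, where $v_j$ is the $j$-th to arrive (the order is fixed in advance). The type $t_j$ of $v_j$ is drawn independently from a known distribution $D_j$ with finite support $T_j$; a type specifies the set of offline neighbours of the vertex. Write $\mathbf{t}=(t_1,\dots,t_n)$, $\mathbf{t}_{\le j}=(t_1,\dots,t_j)$, $\mathbf{t}_{>j}=(t_{j+1},\dots,t_n)$, $\mathbf{t}_{-j}$ for all types except $t_j$. $\mathsf{OPT}(\mathbf{t})$ denotes a maximum-weight matching (weight $=\sum$ of $w_u$ over matched offline $u$) of the realized bipartite graph, selected by a fixed (possibly randomized) rule; probabilities involving $\mathsf{OPT}$ are over the types and this rule. A fractional online algorithm, on arrival of $v_j$, chooses $x_j=(x_{u,j})_{u\in L}\in[0,1]^L$ as a function of $\mathbf{t}_{\le j}$, with $x_{u,j}>0$ only if $u$ is a neighbour of $v_j$ and $\sum_u x_{u,j}\le 1$; with $y_u=\sum_j x_{u,j}$ its value is $\sum_u w_u\min(y_u,1)$. Rounding with OCS: let $p(y)=1-\exp\!\big(-y-\tfrac12 y^2-\tfrac{4-2\sqrt3}{3}y^3\big)$; on arrival of $v_j$, after computing $x_j$, the multiway online correlated selection (OCS) of Gao et al. (FOCS 2021) selects one element $u$ with $x_{u,j}>0$ (a dummy element absorbs mass $1-\sum_u x_{u,j}$), and $v_j$ is matched to $u$ if $u$ is still unmatched; this OCS guarantees, for any fixed sequence $x_1,\dots,x_n$, that each $u$ is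 selected in at least one round with probability at least $p(y_u)$. An algorithm is $\Gamma$-competitive if for every instance its expected value (total weight of matched offline vertices, resp. $\sum_u w_u\min(y_u,1)$ in the fractional case) is at least $\Gamma$ times the expected weight of $\mathsf{OPT}$. *)

theory Defs
  imports "HOL-Probability.Probability"
begin

text \<open>
  Online vertices are numbered from 0: the vertices of an instance are the \<open>j < arrivals I\<close>, in order
  of arrival.  The types \<open>'t\<close> are abstract; \<open>nbrs I\<close> maps a type to the set of offline neighbours it
  specifies.  Type vectors are functions on \<open>nat\<close> that are \<open>undefined\<close> from \<open>arrivals I\<close> on.
\<close>

record ('u, 't) arrival_instance =
  offline :: "'u set"
  weight :: "'u \<Rightarrow> real"
  arrivals :: nat
  type_dist :: "nat \<Rightarrow> 't pmf"
  nbrs :: "'t \<Rightarrow> 'u set"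

definition valid_instance :: "('u, 't) arrival_instance \<Rightarrow> bool" where
  "valid_instance I \<longleftrightarrow>
     finite (offline I) \<and>
     (\<forall>u\<in>offline I. 0 \<le> weight I u) \<and>
     (\<forall>j<arrivals I. finite (set_pmf (type_dist I j)) \<and>
        (\<forall>\<tau>\<in>set_pmf (type_dist I j). nbrs I \<tau> \<subseteq> offline I))"

definition sample_types :: "('u, 't) arrival_instance \<Rightarrow> nat set \<Rightarrow> (nat \<Rightarrow> 't) pmf" where
  "sample_types I A = Pi_pmf A undefined (type_dist I)"

abbreviation types_pmf :: "('u, 't) arrival_instance \<Rightarrow> (nat \<Rightarrow> 't) pmf" where
  "types_pmf I \<equiv> sample_types I {..<arrivals I}"

definition edges :: "('u, 't) arrival_instance \<Rightarrow> (nat \<Rightarrow> 't) \<Rightarrow> ('u \<times> nat) set" where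
  "edges I t = {(u, j). j < arrivals I \<and> u \<in> nbrs I (t j)}"

definition is_matching :: "('u \<times> nat) set \<Rightarrow> ('u \<times> nat) set \<Rightarrow> bool" where
  "is_matching E M \<longleftrightarrow> M \<subseteq> E \<and> inj_on fst M \<and> inj_on snd M"

definition matching_weight :: "('u, 't) arrival_instance \<Rightarrow> ('u \<times> nat) set \<Rightarrow> real" where
  "matching_weight I M = (\<Sum>u\<in>fst ` M. weight I u)"

definition is_max_weight_matching ::
    "('u, 't) arrival_instance \<Rightarrow> (nat \<Rightarrow> 't) \<Rightarrow> ('u \<times> nat) set \<Rightarrow> bool" where
  "is_max_weight_matching I t M \<longleftrightarrow>
     is_matching (edges I t) M \<and>
     (\<forall>M'. is_matching (edges I t) M' \<longrightarrow> matching_weight I M' \<le> matching_weight I M)"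

text \<open>A (possibly randomized) rule mapping each instance and type vector to a random matching.\<close>

type_synonym ('u, 't) matching_rule =
  "('u, 't) arrival_instance \<Rightarrow> (nat \<Rightarrow> 't) \<Rightarrow> ('u \<times> nat) set pmf"

definition optimal_rule :: "('u, 't) matching_rule \<Rightarrow> bool" where
  "optimal_rule opt \<longleftrightarrow>
     (\<forall>I t M. valid_instance I \<longrightarrow> t \<in> set_pmf (types_pmf I) \<longrightarrow> M \<in> set_pmf (opt I t) \<longrightarrow>
        is_max_weight_matching I t M)"

definition expected_weight :: "('u, 't) matching_rule \<Rightarrow> ('u, 't) arrival_instance \<Rightarrow> real" where
  "expected_weight rule I =
     measure_pmf.expectation (bind_pmf (types_pmf I) (rule I)) (matching_weight I)"


text \<open>A fractional algorithm maps an instance, a type vector, and an arrival \<open>j\<close> to the vector \<open>x\<^sub>j\<close>.\<close>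

type_synonym ('u, 't) frac_alg =
  "('u, 't) arrival_instance \<Rightarrow> (nat \<Rightarrow> 't) \<Rightarrow> nat \<Rightarrow> 'u \<Rightarrow> real"

definition frac_online ::
    "('u, 't) arrival_instance \<Rightarrow> ((nat \<Rightarrow> 't) \<Rightarrow> nat \<Rightarrow> 'u \<Rightarrow> real) \<Rightarrow> bool" where
  "frac_online I x \<longleftrightarrow>
     (\<forall>t\<in>set_pmf (types_pmf I). \<forall>j<arrivals I.
        (\<forall>u\<in>offline I. 0 \<le> x t j u \<and> x t j u \<le> 1 \<and> (0 < x t j u \<longrightarrow> u \<in> nbrs I (t j))) \<and>
        (\<Sum>u\<in>offline I. x t j u) \<le> 1) \<and>
     (\<forall>t\<in>set_pmf (types_pmf I). \<forall>t'\<in>set_pmf (types_pmf I). \<forall>j<arrivals I.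
        (\<forall>i\<le>j. t i = t' i) \<longrightarrow> (\<forall>u\<in>offline I. x t j u = x t' j u))"

definition frac_value ::
    "('u, 't) arrival_instance \<Rightarrow> (nat \<Rightarrow> 'u \<Rightarrow> real) \<Rightarrow> real" where
  "frac_value I x = (\<Sum>u\<in>offline I. weight I u * min (\<Sum>j<arrivals I. x j u) 1)"

definition frac_competitive ::
    "('u, 't) matching_rule \<Rightarrow> real \<Rightarrow> ('u, 't) frac_alg \<Rightarrow> bool" where
  "frac_competitive opt \<Gamma> alg \<longleftrightarrow>
     (\<forall>I. valid_instance I \<longrightarrow>
        frac_online I (alg I) \<and>
        measure_pmf.expectation (types_pmf I) (\<lambda>t. frac_value I (alg I t))
          \<ge> \<Gamma> * expected_weight opt I)"


text \<open>
  The output of an integral algorithm is the law of its matching for each type vector.  It is online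
  if the law of the part built up to the arrival of \<open>j\<close> depends on the types up to \<open>j\<close> only.
\<close>

definition integral_online ::
    "('u, 't) arrival_instance \<Rightarrow> ((nat \<Rightarrow> 't) \<Rightarrow> ('u \<times> nat) set pmf) \<Rightarrow> bool" where
  "integral_online I alg \<longleftrightarrow>
     (\<forall>t\<in>set_pmf (types_pmf I). \<forall>M\<in>set_pmf (alg t). is_matching (edges I t) M) \<and>
     (\<forall>t\<in>set_pmf (types_pmf I). \<forall>t'\<in>set_pmf (types_pmf I). \<forall>j<arrivals I.
        (\<forall>i\<le>j. t i = t' i) \<longrightarrow>
        map_pmf (\<lambda>M. {e\<in>M. snd e \<le> j}) (alg t) = map_pmf (\<lambda>M. {e\<in>M. snd e \<le> j}) (alg t'))"

definition integral_competitive ::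
    "('u, 't) matching_rule \<Rightarrow> real \<Rightarrow> ('u, 't) matching_rule \<Rightarrow> bool" where
  "integral_competitive opt \<Gamma> alg \<longleftrightarrow>
     (\<forall>I. valid_instance I \<longrightarrow>
        integral_online I (alg I) \<and> expected_weight alg I \<ge> \<Gamma> * expected_weight opt I)"


text \<open>
  In \<open>opt_frac\<close>, the fresh samples are drawn together with fresh randomness of the rule \<open>opt\<close>.
\<close>

definition opt_frac :: "('u, 't) matching_rule \<Rightarrow> ('u, 't) frac_alg" where
  "opt_frac opt I t j u =
     1/2 * measure_pmf.prob
             (bind_pmf (sample_types I ({..<arrivals I} - {j})) (\<lambda>s. opt I (s(j := t j))))
             {M. (u, j) \<in> M} +
     1/2 * measure_pmf.prob
             (bind_pmf (sample_types I {j<..<arrivals I})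
                (\<lambda>s. opt I (\<lambda>i. if i \<le> j then t i else s i)))
             {M. (u, j) \<in> M}"


text \<open>
  A multiway online selection procedure on the ground set \<open>L\<close> is given by the conditional law of the
  element selected in the current round, given the vectors \<open>x\<^sub>0, \<dots>, x\<^sub>j\<close> seen so far (including the
  current one) and its own selections in the earlier rounds.  Up to the law of the selections, this
  covers every procedure with internal state.  \<open>None\<close> is the dummy element.
\<close>

type_synonym 'u selector = "'u set \<Rightarrow> ('u \<Rightarrow> real) list \<Rightarrow> 'u option list \<Rightarrow> 'u option pmf"

primrec run_selector ::
    "'u selector \<Rightarrow> 'u set \<Rightarrow> (nat \<Rightarrow> 'u \<Rightarrow> real) \<Rightarrow> nat \<Rightarrow> 'u option list pmf" where
  "run_selector sel L x 0 = return_pmf []"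
| "run_selector sel L x (Suc j) =
     bind_pmf (run_selector sel L x j)
       (\<lambda>h. map_pmf (\<lambda>a. h @ [a]) (sel L (map x [0..<Suc j]) h))"

definition selection_vector :: "'u set \<Rightarrow> ('u \<Rightarrow> real) \<Rightarrow> bool" where
  "selection_vector L x \<longleftrightarrow>
     (\<forall>u\<in>L. 0 \<le> x u \<and> x u \<le> 1) \<and> (\<forall>u. u \<notin> L \<longrightarrow> x u = 0) \<and> (\<Sum>u\<in>L. x u) \<le> 1"

definition selection_mass :: "'u set \<Rightarrow> ('u \<Rightarrow> real) \<Rightarrow> 'u option \<Rightarrow> real" where
  "selection_mass L x a = (case a of None \<Rightarrow> 1 - (\<Sum>u\<in>L. x u) | Some u \<Rightarrow> x u)"

definition is_ocs :: "(real \<Rightarrow> real) \<Rightarrow> 'u selector \<Rightarrow> bool" where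
  "is_ocs p sel \<longleftrightarrow>
     (\<forall>L x n. finite L \<longrightarrow> (\<forall>j<n. selection_vector L (x j)) \<longrightarrow>
        (\<forall>h\<in>set_pmf (run_selector sel L x n). \<forall>j<n. 0 < selection_mass L (x j) (h ! j)) \<and>
        (\<forall>u\<in>L. p (\<Sum>j<n. x j u)
                 \<le> measure_pmf.prob (run_selector sel L x n) {h. Some u \<in> set h}))"

definition ocs_bound :: "real \<Rightarrow> real" where
  "ocs_bound y = 1 - exp (- y - 1/2 * y^2 - (4 - 2 * sqrt 3) / 3 * y^3)"

text \<open>The matching after the first \<open>j\<close> arrivals, given the list \<open>h\<close> of selections.\<close>

primrec greedy_matching :: "'u option list \<Rightarrow> nat \<Rightarrow> ('u \<times> nat) set" where
  "greedy_matching h 0 = {}"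
| "greedy_matching h (Suc j) =
     (case h ! j of
        None \<Rightarrow> greedy_matching h j
      | Some u \<Rightarrow>
          if u \<in> fst ` greedy_matching h j then greedy_matching h j
          else insert (u, j) (greedy_matching h j))"

definition ocs_rounding :: "'u selector \<Rightarrow> ('u, 't) frac_alg \<Rightarrow> ('u, 't) matching_rule" where
  "ocs_rounding sel alg I t =
     map_pmf (\<lambda>h. greedy_matching h (arrivals I))
       (run_selector sel (offline I) (alg I t) (arrivals I))"

end

theory Submission
  imports Defs
begin

text \<open>
  Fix an offline vertex \<open>u\<close> and let \<open>Z\<^sub>j\<close> be the probability, given the types, that \<open>(u, v\<^sub>j)\<close> is in the
  optimal matching, \<open>A\<^sub>j = E[Z\<^sub>j | t\<^sub>j]\<close>, \<open>B\<^sub>j = E[Z\<^sub>j | t\<^sub>1, \<dots>, t\<^sub>j]\<close>, so that \<open>u\<close> receives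
  \<open>y = \<Sum>\<^sub>j (A\<^sub>j + B\<^sub>j) / 2\<close>, with mean \<open>q = E[\<Sum>\<^sub>j Z\<^sub>j]\<close>.  Expanding the square, the terms
  \<open>A\<^sub>i A\<^sub>j\<close> and \<open>B\<^sub>i A\<^sub>j\<close> with \<open>i < j\<close> factor by independence, while in \<open>A\<^sub>i B\<^sub>j\<close> and \<open>B\<^sub>i B\<^sub>j\<close> the factor
  \<open>B\<^sub>j\<close> can be replaced by \<open>Z\<^sub>j\<close>.  Since \<open>\<Sum>\<^sub>j\<^sub>>\<^sub>i Z\<^sub>j \<le> 1 - Z\<^sub>i\<close>, this yields \<open>E[y\<^sup>2] \<le> q + q\<^sup>2 / 2\<close>.  Both
  ratios follow from these two moments by quadratic minorants of \<open>min y 1\<close> and of \<open>ocs_bound y\<close>; the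
  worst case is \<open>q = 1\<close>.
\<close>

section \<open>Quadratic minorants of \<open>ocs_bound\<close>\<close>

lemma exp_ge_taylor_sum:
  fixes x :: real
  assumes "0 \<le> x"
  shows "(\<Sum>k<n. x ^ k / fact k) \<le> exp x"
proof -
  have "(\<lambda>k. x ^ k / fact k) sums exp x"
    using exp_converges[of x] by (simp add: field_simps)
  then show ?thesis
    using assms sum_le_suminf[of "\<lambda>k. x ^ k / fact k" "{..<n}"] by (auto simp: sums_iff)
qed

text \<open>The exponent of \<open>ocs_bound\<close> with its irrational cubic coefficient rounded
  down to \<open>0.1786 = (4 - 2 * 1.7321) / 3\<close>, which leaves only rational
  arithmetic.\<close>

definition ocs_exponent :: "real \<Rightarrow> real" where
  "ocs_exponent y = y + y\<^sup>2 / 2 + 0.1786 * y ^ 3"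

lemma ocs_bound_ge:
  assumes "0 \<le> y"
  shows "1 - exp (- ocs_exponent y) \<le> ocs_bound y"
proof -
  have "sqrt 3 \<le> 1.7321"
    by (rule real_le_lsqrt) (auto simp: power2_eq_square)
  then have "0.1786 * y ^ 3 \<le> (4 - 2 * sqrt 3) / 3 * y ^ 3"
    using assms by (intro mult_right_mono) auto
  then show ?thesis
    unfolding ocs_bound_def ocs_exponent_def by simp
qed

lemma ocs_exponent_mono:
  assumes "0 \<le> x" "x \<le> y"
  shows "ocs_exponent x \<le> ocs_exponent y"
  unfolding ocs_exponent_def
  using assms by (intro add_mono mult_left_mono divide_right_mono power_mono) auto

text \<open>With \<open>g = ocs_exponent\<close> the second derivative is
  \<open>(g'^2 - g'') exp (- g)\<close>. It is nonnegative because \<open>g' \<ge> 1 + y\<close> and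
  \<open>g'' = 1 + 1.0716 y \<le> (1 + y)^2\<close>.\<close>

lemma convex_on_exp_ocs_exponent: "convex_on {0..} (\<lambda>y. exp (- ocs_exponent y))"
proof (rule f''_ge0_imp_convex)
  let ?g' = "\<lambda>y :: real. 1 + y + 0.5358 * y\<^sup>2"
  fix y :: real
  assume y: "y \<in> {0..}"
  have g: "(ocs_exponent has_real_derivative ?g' y) (at y)"
    unfolding ocs_exponent_def [abs_def]
    by (auto intro!: derivative_eq_intros simp: power2_eq_square)
  have g': "(?g' has_real_derivative 1 + 1.0716 * y) (at y)"
    by (auto intro!: derivative_eq_intros)
  show e: "((\<lambda>y. exp (- ocs_exponent y)) has_real_derivative - ?g' y * exp (- ocs_exponent y)) (at y)"
    by (rule derivative_eq_intros g refl)+ simp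
  show "((\<lambda>y. - ?g' y * exp (- ocs_exponent y)) has_real_derivative
          ((?g' y)\<^sup>2 - (1 + 1.0716 * y)) * exp (- ocs_exponent y)) (at y)"
  proof -
    have "- h * e + - g * e * - g = (g\<^sup>2 - h) * e" for e g h :: real
      by (simp add: power2_eq_square algebra_simps)
    with DERIV_mult[OF DERIV_minus[OF g'] e] show ?thesis
      by metis
  qed
  have "(1 + y)\<^sup>2 \<le> (?g' y)\<^sup>2"
    using y by (intro power_mono) auto
  then have "1 + 1.0716 * y \<le> (?g' y)\<^sup>2"
    using y zero_le_power2[of y] by (simp add: power2_sum)
  then show "0 \<le> ((?g' y)\<^sup>2 - (1 + 1.0716 * y)) * exp (- ocs_exponent y)"
    by simp
qed auto

text \<open>A convex \<open>f\<close> lies below its chord, while the quadratic dips below its own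
  chord by \<open>\<beta> (y - a) (b - y)\<close>, at most \<open>\<beta> (b - a)^2 / 4\<close>. A
  margin of that size at both endpoints therefore controls the whole interval.\<close>

lemma convex_on_below_quadratic:
  fixes f :: "real \<Rightarrow> real"
  assumes "convex_on S f" "a \<in> S" "b \<in> S" "a \<le> y" "y \<le> b" "0 \<le> \<beta>"
    and fa: "f a + \<beta> * (b - a)\<^sup>2 / 4 \<le> \<gamma> - \<alpha> * a + \<beta> * a\<^sup>2"
    and fb: "f b + \<beta> * (b - a)\<^sup>2 / 4 \<le> \<gamma> - \<alpha> * b + \<beta> * b\<^sup>2"
  shows "f y \<le> \<gamma> - \<alpha> * y + \<beta> * y\<^sup>2"
proof (cases "a = b")
  case True
  then show ?thesis using assms by auto
next
  case False
  define s where "s = (y - a) / (b - a)"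
  have s: "0 \<le> s" "s \<le> 1"
    using assms False by (auto simp: s_def)
  have "s * (b - a) = y - a"
    using False by (simp add: s_def)
  then have y: "y = (1 - s) * a + s * b"
    by (simp add: algebra_simps)
  have "f y \<le> (1 - s) * f a + s * f b"
    using convex_onD[OF assms(1) s assms(2,3)] by (simp add: y)
  also have "\<dots> \<le> (1 - s) * (\<gamma> - \<alpha> * a + \<beta> * a\<^sup>2 - \<beta> * (b - a)\<^sup>2 / 4)
                + s * (\<gamma> - \<alpha> * b + \<beta> * b\<^sup>2 - \<beta> * (b - a)\<^sup>2 / 4)"
    using s fa fb by (intro add_mono mult_left_mono) auto
  also have "\<dots> = \<gamma> - \<alpha> * y + \<beta> * y\<^sup>2 - \<beta> * ((b - a) * (s - 1/2))\<^sup>2"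
    by (simp add: y power2_eq_square field_simps)
  also have "\<dots> \<le> \<gamma> - \<alpha> * y + \<beta> * y\<^sup>2"
    using \<open>0 \<le> \<beta>\<close> by simp
  finally show ?thesis .
qed

text \<open>Reduces a numerical bound to rational arithmetic: \<open>exp (-1) \<le> 0.3679\<close>
  handles the integer part \<open>n\<close> of the exponent, and the Taylor polynomial of degree 5
  bounds \<open>exp t\<close> from below.\<close>

lemma exp_ocs_exponent_le:
  assumes "0 \<le> t" "real n + t \<le> ocs_exponent y" "0 \<le> r"
    and "0.3679 ^ n \<le> r * (1 + t + t\<^sup>2 / 2 + t ^ 3 / 6 + t ^ 4 / 24 + t ^ 5 / 120)"
  shows "exp (- ocs_exponent y) \<le> r"
proof -
  have "1 / 0.3679 \<le> exp (1 :: real)"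
    using exp_ge_taylor_sum[of 1 8] by (simp add: eval_nat_numeral)
  then have "exp (- 1 :: real) \<le> 0.3679"
    by (simp add: exp_minus field_simps)
  then have "exp (- 1 :: real) ^ n \<le> 0.3679 ^ n"
    by (rule power_mono) simp
  also have "\<dots> \<le> r * exp t"
    using assms(4) exp_ge_taylor_sum[OF \<open>0 \<le> t\<close>, of 6] \<open>0 \<le> r\<close>
    by (elim order_trans, intro mult_left_mono) (simp_all add: eval_nat_numeral)
  finally have "exp (- (real n + t)) \<le> r"
    by (simp add: exp_of_nat_mult[symmetric] exp_minus exp_add exp_diff field_simps)
  moreover have "exp (- ocs_exponent y) \<le> exp (- (real n + t))"
    using assms(2) by simp
  ultimately show ?thesis
    by (rule order_trans[rotated])
qed

text \<open>Values at the breakpoints of the grid on which \<open>ocs_bound_ge_quadratic\<close> is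
  checked. In each case \<open>n\<close> is the integer part of \<open>ocs_exponent\<close> at the
  point and \<open>t\<close> a lower bound for the fractional part.\<close>

lemma exp_ocs_exponent_grid:
  shows "exp (- ocs_exponent 0.15) \<le> 0.851"
    and "exp (- ocs_exponent 0.26) \<le> 0.7432"
    and "exp (- ocs_exponent 0.37) \<le> 0.6393"
    and "exp (- ocs_exponent 0.59) \<le> 0.4491"
    and "exp (- ocs_exponent 1.02) \<le> 0.18"
    and "exp (- ocs_exponent 1.35) \<le> 0.0672"
    and "exp (- ocs_exponent 1.51) \<le> 0.0383"
    and "exp (- ocs_exponent 1.59) \<le> 0.0282"
    and "exp (- ocs_exponent 1.68) \<le> 0.0195"
    and "exp (- ocs_exponent 1.78) \<le> 0.013"
    and "exp (- ocs_exponent 2.0) \<le> 0.01"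
    apply (rule exp_ocs_exponent_le[where n = 0 and t = "0.1618"]; simp add: ocs_exponent_def power_divide)
    apply (rule exp_ocs_exponent_le[where n = 0 and t = "0.2969"]; simp add: ocs_exponent_def power_divide)
    apply (rule exp_ocs_exponent_le[where n = 0 and t = "0.4474"]; simp add: ocs_exponent_def power_divide)
    apply (rule exp_ocs_exponent_le[where n = 0 and t = "0.8007"]; simp add: ocs_exponent_def power_divide)
    apply (rule exp_ocs_exponent_le[where n = 1 and t = "0.72"]; simp add: ocs_exponent_def power_divide)
    apply (rule exp_ocs_exponent_le[where n = 2 and t = "0.7006"]; simp add: ocs_exponent_def power_divide)
    apply (rule exp_ocs_exponent_le[where n = 3 and t = "0.264"]; simp add: ocs_exponent_def power_divide)
    apply (rule exp_ocs_exponent_le[where n = 3 and t = "0.57"]; simp add: ocs_exponent_def power_divide)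
    apply (rule exp_ocs_exponent_le[where n = 3 and t = "0.938"]; simp add: ocs_exponent_def power_divide)
    apply (rule exp_ocs_exponent_le[where n = 4 and t = "0.37"]; simp add: ocs_exponent_def power_divide)
    apply (rule exp_ocs_exponent_le[where n = 5 and t = "0.4"]; simp add: ocs_exponent_def power_divide)
  done

text \<open>
  Among the quadratic minorants \<open>\<alpha> y - \<beta> y\<^sup>2 - \<gamma>\<close> of \<open>ocs_bound y\<close>, these coefficients nearly maximize
  \<open>\<alpha> - 3/2 \<beta> - \<gamma>\<close>, the bound obtained for \<open>q = 1\<close>.  The gap is below \<open>0.001\<close> near \<open>y = 0.23\<close>
  and \<open>y = 1.63\<close>, hence the finer grid there.
\<close>

lemma ocs_bound_ge_quadratic:
  assumes "0 \<le> y"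
  shows "1.115 * y - 0.312 * y\<^sup>2 - 0.013 \<le> ocs_bound y"
proof -
  let ?e = "\<lambda>y. exp (- ocs_exponent y)" and ?q = "\<lambda>y :: real. 1.013 - 1.115 * y + 0.312 * y\<^sup>2"
  \<comment> \<open>The range \<open>[0, b]\<close> on which the bound is established grows along
    the grid; \<open>step\<close> adds one interval by convexity.\<close>
  define below where "below b \<longleftrightarrow> (\<forall>y. 0 \<le> y \<longrightarrow> y \<le> b \<longrightarrow> ?e y \<le> ?q y)" for b
  have step: "below b" if "below a" "0 \<le> a" "a \<le> b"
    and "?e a + 0.312 * (b - a)\<^sup>2 / 4 \<le> ?q a"
    and "?e b + 0.312 * (b - a)\<^sup>2 / 4 \<le> ?q b" for a b
    unfolding below_def
  proof (intro allI impI)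
    fix y
    assume "0 \<le> y" "y \<le> b"
    show "?e y \<le> ?q y"
    proof (cases "y \<le> a")
      case True
      with \<open>below a\<close> \<open>0 \<le> y\<close> show ?thesis
        by (simp add: below_def)
    next
      case False
      show ?thesis
        by (rule convex_on_below_quadratic[OF convex_on_exp_ocs_exponent, of a b])
           (use that False \<open>y \<le> b\<close> in auto)
    qed
  qed
  note grid = exp_ocs_exponent_grid
  have "below 0"
    by (auto simp: below_def ocs_exponent_def)
  then have "below 0.15"
    by (rule step) (use grid(1) in \<open>simp_all add: ocs_exponent_def power_divide\<close>)
  then have "below 0.26"
    by (rule step) (use grid(1) grid(2) in \<open>simp_all add: power_divide\<close>)
  then have "below 0.37"
    by (rule step) (use grid(2) grid(3) in \<open>simp_all add: power_divide\<close>)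
  then have "below 0.59"
    by (rule step) (use grid(3) grid(4) in \<open>simp_all add: power_divide\<close>)
  then have "below 1.02"
    by (rule step) (use grid(4) grid(5) in \<open>simp_all add: power_divide\<close>)
  then have "below 1.35"
    by (rule step) (use grid(5) grid(6) in \<open>simp_all add: power_divide\<close>)
  then have "below 1.51"
    by (rule step) (use grid(6) grid(7) in \<open>simp_all add: power_divide\<close>)
  then have "below 1.59"
    by (rule step) (use grid(7) grid(8) in \<open>simp_all add: power_divide\<close>)
  then have "below 1.68"
    by (rule step) (use grid(8) grid(9) in \<open>simp_all add: power_divide\<close>)
  then have "below 1.78"
    by (rule step) (use grid(9) grid(10) in \<open>simp_all add: power_divide\<close>)
  then have "below 2.0"
    by (rule step) (use grid(10) grid(11) in \<open>simp_all add: power_divide\<close>)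
  then have "?e y \<le> ?q y" if "y \<le> 2.0"
    using that assms by (simp add: below_def)
  moreover have "?e y \<le> ?q y" if "2.0 \<le> y"
  proof -
    have "?e y \<le> 0.01"
      using ocs_exponent_mono[of "2.0" y] that by (intro order_trans[OF _ grid(11)]) simp
    \<comment> \<open>The vertex of the quadratic is at \<open>1.115 / 0.624\<close>, and its
      minimum exceeds \<open>0.016\<close>, more than the exponential can reach beyond
      \<open>2.0\<close>.\<close>
    moreover have "0 \<le> (y - 1.115 / 0.624)\<^sup>2"
      by simp
    ultimately show ?thesis
      by (simp add: power2_eq_square algebra_simps)
  qed
  ultimately have "?e y \<le> ?q y"
    by linarith
  with ocs_bound_ge[OF assms] show ?thesis
    by simp
qed

text \<open>A minorant without constant term, needed for small \<open>q\<close>, where the constant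
  \<open>0.013\<close> of the previous one is too costly. After multiplying by
  \<open>exp (ocs_exponent y)\<close>, the claim follows from the quadratic Taylor bound for
  \<open>exp\<close>.\<close>

lemma ocs_bound_ge_quadratic_small:
  assumes "0 \<le> y"
  shows "y - 33 / 100 * y\<^sup>2 \<le> ocs_bound y"
proof -
  let ?g = "ocs_exponent y" and ?q = "1 - y + 33 / 100 * y\<^sup>2"
  have q: "0 < ?q"
  proof -
    have "0 \<le> (y - 1 / 0.66)\<^sup>2"
      by simp
    then show ?thesis
      by (simp add: power2_eq_square algebra_simps)
  qed
  \<comment> \<open>The coefficient \<open>0.67 = 1 - 0.33\<close> makes the cubic term of the
    product with the quadratic vanish.\<close>
  have "1 + y + y\<^sup>2 + 67 / 100 * y ^ 3 \<le> 1 + ?g + ?g\<^sup>2 / 2"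
  proof -
    have "(y + y\<^sup>2 / 2)\<^sup>2 \<le> ?g\<^sup>2"
      using assms by (intro power_mono) (auto simp: ocs_exponent_def)
    moreover have "(y + y\<^sup>2 / 2)\<^sup>2 = y\<^sup>2 + y ^ 3 + y ^ 4 / 4"
      by (simp add: power2_eq_square power3_eq_cube power4_eq_xxxx algebra_simps)
    moreover have "0 \<le> y ^ 3" "0 \<le> y ^ 4"
      using assms by auto
    moreover have "?g = y + y\<^sup>2 / 2 + 893 / 5000 * y ^ 3"
      by (simp add: ocs_exponent_def)
    ultimately show ?thesis
      by linarith
  qed
  also have "\<dots> \<le> exp ?g"
    using exp_lower_Taylor_quadratic[of ?g] assms by (simp add: ocs_exponent_def)
  finally have "?q * (1 + y + y\<^sup>2 + 67 / 100 * y ^ 3) \<le> ?q * exp ?g"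
    using q by (intro mult_left_mono) auto
  moreover have "?q * (1 + y + y\<^sup>2 + 67 / 100 * y ^ 3)
      = 1 + y\<^sup>2 * (33 / 100 - 34 / 100 * y\<^sup>2 + 2211 / 10000 * y ^ 3)"
    by (simp add: power2_eq_square power3_eq_cube algebra_simps)
  moreover have "0 \<le> 33 / 100 - 34 / 100 * y\<^sup>2 + 2211 / 10000 * y ^ 3"
  proof -
    \<comment> \<open>The double root \<open>1.03\<close> approximates the minimizer
      \<open>0.68 / 0.6633\<close> of the cubic; the third root \<open>-1.03 / 2\<close> cancels the
      linear term.\<close>
    have "0 \<le> (y - 103 / 100)\<^sup>2 * (y + 103 / 200)"
      using assms by simp
    also have "\<dots> = y ^ 3 - 309 / 200 * y\<^sup>2 + 1092727 / 2000000"
      by (simp add: power2_eq_square power3_eq_cube algebra_simps)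
    finally show ?thesis
      using zero_le_power2[of y] by linarith
  qed
  ultimately have "1 \<le> ?q * exp ?g"
    by (smt (verit) mult_nonneg_nonneg zero_le_power2)
  then have "exp (- ?g) \<le> ?q"
    by (simp add: exp_minus field_simps)
  with ocs_bound_ge[OF assms] show ?thesis
    by simp
qed

section \<open>The first two moments of the load of an offline vertex\<close>

lemma finite_set_Pi_pmf:
  assumes "finite A" "\<And>i. i \<in> A \<Longrightarrow> finite (set_pmf (p i))"
  shows "finite (set_pmf (Pi_pmf A d p))"
  using assms by (subst set_Pi_pmf) (auto intro!: finite_PiE_dflt)

lemma expectation_bind_pmf_finite:
  fixes h :: "'b \<Rightarrow> real"
  assumes "finite (set_pmf p)" "\<And>x. x \<in> set_pmf p \<Longrightarrow> finite (set_pmf (f x))"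
  shows "measure_pmf.expectation (bind_pmf p f) h =
    measure_pmf.expectation p (\<lambda>x. measure_pmf.expectation (f x) h)"
  using assms pmf_expectation_bind[of "set_pmf p" f p h]
  by (simp add: integral_measure_pmf[of "set_pmf p"])

lemma measure_bind_pmf_finite:
  assumes "finite (set_pmf p)"
  shows "measure_pmf.prob (bind_pmf p f) S =
    measure_pmf.expectation p (\<lambda>x. measure_pmf.prob (f x) S)"
proof -
  have "ennreal (measure_pmf.prob (bind_pmf p f) S) = (\<integral>\<^sup>+x. ennreal (measure_pmf.prob (f x) S) \<partial>measure_pmf p)"
    by (simp add: measure_pmf.emeasure_eq_measure[symmetric])
  also have "\<dots> = ennreal (measure_pmf.expectation p (\<lambda>x. measure_pmf.prob (f x) S))"
    by (intro nn_integral_eq_integral integrable_measure_pmf_finite assms) auto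
  finally show ?thesis
    by (simp add: integral_nonneg_AE)
qed

lemma expectation_mono_pmf:
  fixes f g :: "'a \<Rightarrow> real"
  assumes "finite (set_pmf p)" "\<And>x. x \<in> set_pmf p \<Longrightarrow> f x \<le> g x"
  shows "measure_pmf.expectation p f \<le> measure_pmf.expectation p g"
  using assms by (intro integral_mono_AE integrable_measure_pmf_finite) (auto simp: AE_measure_pmf_iff)

lemma expectation_cong_pmf:
  fixes f g :: "'a \<Rightarrow> real"
  assumes "\<And>x. x \<in> set_pmf p \<Longrightarrow> f x = g x"
  shows "measure_pmf.expectation p f = measure_pmf.expectation p g"
  using assms by (intro integral_cong_AE) (auto simp: AE_measure_pmf_iff)

section \<open>Conditional expectations over finitely many independent types\<close>

definition depends_on :: "'i set \<Rightarrow> (('i \<Rightarrow> 't) \<Rightarrow> 'a) \<Rightarrow> bool" where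
  "depends_on A G \<longleftrightarrow> (\<forall>t t'. (\<forall>i\<in>A. t i = t' i) \<longrightarrow> G t = G t')"

lemma depends_onD: "depends_on A G \<Longrightarrow> (\<And>i. i \<in> A \<Longrightarrow> t i = t' i) \<Longrightarrow> G t = G t'"
  by (auto simp: depends_on_def)

lemma depends_on_mono: "depends_on A G \<Longrightarrow> A \<subseteq> B \<Longrightarrow> depends_on B G"
  by (auto simp: depends_on_def)

locale finite_product =
  fixes N :: "'i set" and d :: 't and D :: "'i \<Rightarrow> 't pmf"
  assumes finite_N: "finite N"
    and finite_D: "\<And>i. i \<in> N \<Longrightarrow> finite (set_pmf (D i))"
begin

abbreviation E :: "(('i \<Rightarrow> 't) \<Rightarrow> real) \<Rightarrow> real" where
  "E \<equiv> measure_pmf.expectation (Pi_pmf N d D)"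

text \<open>The conditional expectation given the coordinates in \<open>A\<close>, encoded as an
  integral over fresh values of the others. It is thus defined pointwise and has the same form as
  the resampling in \<open>opt_frac\<close>.\<close>

definition cond :: "'i set \<Rightarrow> (('i \<Rightarrow> 't) \<Rightarrow> real) \<Rightarrow> ('i \<Rightarrow> 't) \<Rightarrow> real" where
  "cond A F t = measure_pmf.expectation (Pi_pmf (N - A) d D) (\<lambda>s. F (\<lambda>i. if i \<in> A then t i else s i))"

lemma finite_support: "A \<subseteq> N \<Longrightarrow> finite (set_pmf (Pi_pmf A d D))"
  using finite_N finite_D by (intro finite_set_Pi_pmf) (auto dest: finite_subset)

lemma integrable: "integrable (measure_pmf (Pi_pmf N d D)) F" for F :: "_ \<Rightarrow> real"
  by (intro integrable_measure_pmf_finite finite_support) simp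

lemma E_add: "E (\<lambda>t. F t + G t) = E F + E G"
  by (intro Bochner_Integration.integral_add integrable)

lemma E_diff: "E (\<lambda>t. F t - G t) = E F - E G"
  by (intro Bochner_Integration.integral_diff integrable)

lemma E_sum: "E (\<lambda>t. \<Sum>k\<in>K. F k t) = (\<Sum>k\<in>K. E (F k))"
  by (intro Bochner_Integration.integral_sum integrable)

lemma E_mono: "(\<And>t. t \<in> set_pmf (Pi_pmf N d D) \<Longrightarrow> F t \<le> G t) \<Longrightarrow> E F \<le> E G"
  by (intro expectation_mono_pmf finite_support) auto

lemma depends_on_cond: "depends_on A (cond A F)"
  unfolding depends_on_def
proof (intro allI impI)
  fix t t' :: "'i \<Rightarrow> 't"
  assume "\<forall>i\<in>A. t i = t' i"
  then have "(\<lambda>i. if i \<in> A then t i else s i) = (\<lambda>i. if i \<in> A then t' i else s i)" for s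
    by auto
  then show "cond A F t = cond A F t'"
    by (simp add: cond_def)
qed

lemma merge_in_support:
  assumes "A \<subseteq> N" "t \<in> set_pmf (Pi_pmf N d D)" "s \<in> set_pmf (Pi_pmf (N - A) d D)"
  shows "(\<lambda>i. if i \<in> A then t i else s i) \<in> set_pmf (Pi_pmf N d D)"
  using assms finite_N finite_subset[OF \<open>A \<subseteq> N\<close>] by (auto simp: set_Pi_pmf PiE_dflt_def)

lemma cond_mono:
  assumes "A \<subseteq> N" "t \<in> set_pmf (Pi_pmf N d D)"
    and "\<And>t. t \<in> set_pmf (Pi_pmf N d D) \<Longrightarrow> F t \<le> G t"
  shows "cond A F t \<le> cond A G t"
  unfolding cond_def
  by (intro expectation_mono_pmf finite_support assms(3) merge_in_support assms(1,2)) auto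

lemma cond_const: "cond A (\<lambda>_. c) t = c"
  by (simp add: cond_def)

text \<open>Fubini: by independence the coordinates in \<open>A\<close> can be drawn first and the
  remaining ones afterwards.\<close>

lemma E_merge:
  assumes "A \<subseteq> N"
  shows "E F = measure_pmf.expectation (Pi_pmf A d D) (cond A F)"
proof -
  have "Pi_pmf N d D = Pi_pmf (A \<union> (N - A)) d D"
    using assms by (simp add: Un_absorb1)
  also have "\<dots> = map_pmf (\<lambda>(f, g) x. if x \<in> A then f x else g x)
      (pair_pmf (Pi_pmf A d D) (Pi_pmf (N - A) d D))"
    using assms finite_N by (intro Pi_pmf_union) (auto dest: finite_subset)
  also have "\<dots> = bind_pmf (Pi_pmf A d D)
      (\<lambda>f. map_pmf (\<lambda>g x. if x \<in> A then f x else g x) (Pi_pmf (N - A) d D))"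
    by (simp add: pair_pmf_def map_bind_pmf map_pmf_def bind_assoc_pmf bind_return_pmf)
  finally show ?thesis
    using assms finite_support[of A] finite_support[of "N - A"]
    by (simp add: expectation_bind_pmf_finite cond_def[abs_def])
qed

text \<open>Given the coordinates in \<open>A\<close>, the factor \<open>G\<close> is constant and
  leaves the inner integral; idempotence of \<open>cond A\<close> then identifies the two
  sides.\<close>

lemma E_mult_cond:
  assumes "A \<subseteq> N" "depends_on A G"
  shows "E (\<lambda>t. G t * F t) = E (\<lambda>t. G t * cond A F t)"
proof -
  have pull: "cond A (\<lambda>t. G t * H t) t = G t * cond A H t" for H t
  proof -
    have "G (\<lambda>i. if i \<in> A then t i else s i) = G t" for s
      by (rule depends_onD[OF assms(2)]) simp
    then show ?thesis
      by (simp add: cond_def)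
  qed
  have "cond A (cond A F) t = cond A F t" for F t
  proof -
    have "cond A F (\<lambda>i. if i \<in> A then t i else s i) = cond A F t" for s
      by (rule depends_onD[OF depends_on_cond]) simp
    then show ?thesis
      by (simp add: cond_def[of A "cond A F"])
  qed
  then show ?thesis
    by (simp add: E_merge[OF \<open>A \<subseteq> N\<close>] pull fun_eq_iff cong: Bochner_Integration.integral_cong)
qed

lemma E_cond: "A \<subseteq> N \<Longrightarrow> E (cond A F) = E F"
  using E_mult_cond[of A "\<lambda>_. 1" F] by (simp add: depends_on_def)

text \<open>Resampling outside \<open>A\<close> redraws everything \<open>H\<close> looks at, so
  \<open>cond A H\<close> is constant, with value \<open>E H\<close>.\<close>

lemma E_mult_indep:
  assumes "A \<subseteq> N" "B \<subseteq> N" "A \<inter> B = {}" "depends_on A G" "depends_on B H"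
  shows "E (\<lambda>t. G t * H t) = E G * E H"
proof -
  have "cond A H t = cond A H t'" for t t'
  proof -
    have "H (\<lambda>i. if i \<in> A then t i else s i) = H (\<lambda>i. if i \<in> A then t' i else s i)" for s
      using assms(3) by (intro depends_onD[OF assms(5)]) auto
    then show ?thesis
      by (simp add: cond_def)
  qed
  then obtain c where c: "cond A H = (\<lambda>_. c)"
    by (metis ext)
  then have "c = E H"
    using E_cond[OF \<open>A \<subseteq> N\<close>, of H] by simp
  with c show ?thesis
    using E_mult_cond[OF assms(1,4), of H] by simp
qed

end

section \<open>Second moment of the load\<close>

lemma square_sum_lessThan:
  fixes f :: "nat \<Rightarrow> 'a :: comm_ring_1"
  shows "(\<Sum>j<n. f j)\<^sup>2 = (\<Sum>j<n. (f j)\<^sup>2) + 2 * (\<Sum>j<n. \<Sum>i<j. f i * f j)"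
proof (induction n)
  case (Suc n)
  then show ?case
    by (simp add: power2_sum algebra_simps sum_distrib_left sum_distrib_right)
qed simp

lemma sum_lessThan_triangle_swap:
  fixes f :: "nat \<Rightarrow> nat \<Rightarrow> 'a :: comm_monoid_add"
  shows "(\<Sum>j<n. \<Sum>i<j. f i j) = (\<Sum>i<n. \<Sum>j\<in>{i<..<n}. f i j)"
proof -
  have "(\<Sum>j<n. \<Sum>i\<in>{i \<in> {..<n}. i < j}. f i j) = (\<Sum>i<n. \<Sum>j\<in>{j \<in> {..<n}. i < j}. f i j)"
    by (rule sum.swap_restrict) auto
  moreover have "{i \<in> {..<n}. i < j} = {..<j}" if "j < n" for j
    using that by auto
  moreover have "{j \<in> {..<n}. i < j} = {i<..<n}" for i
    by auto
  ultimately show ?thesis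
    by simp
qed

text \<open>Abstracts one offline vertex: \<open>Z j t\<close> is to be the probability that it is
  matched to arrival \<open>j\<close> under types \<open>t\<close>. That these probabilities add up
  to at most 1 is all that is retained of the matching constraint.\<close>

locale offline_statistics = finite_product "{..<n}" d D
  for n :: nat and d :: 't and D :: "nat \<Rightarrow> 't pmf" +
  fixes Z :: "nat \<Rightarrow> (nat \<Rightarrow> 't) \<Rightarrow> real"
  assumes Z_nonneg: "\<And>t j. t \<in> set_pmf (Pi_pmf {..<n} d D) \<Longrightarrow> j < n \<Longrightarrow> 0 \<le> Z j t"
    and Z_sum_le_1: "\<And>t. t \<in> set_pmf (Pi_pmf {..<n} d D) \<Longrightarrow> (\<Sum>j<n. Z j t) \<le> 1"
begin

abbreviation "A j \<equiv> cond {j} (Z j)"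
abbreviation "B j \<equiv> cond {..j} (Z j)"

definition y :: "(nat \<Rightarrow> 't) \<Rightarrow> real" where "y t = (\<Sum>j<n. (A j t + B j t) / 2)"
definition q :: real where "q = E (\<lambda>t. \<Sum>j<n. Z j t)"

lemma A_nonneg: "t \<in> set_pmf (Pi_pmf {..<n} d D) \<Longrightarrow> j < n \<Longrightarrow> 0 \<le> A j t"
  using cond_mono[of "{j}" t "\<lambda>_. 0" "Z j"] Z_nonneg by (simp add: cond_const)

lemma B_nonneg: "t \<in> set_pmf (Pi_pmf {..<n} d D) \<Longrightarrow> j < n \<Longrightarrow> 0 \<le> B j t"
  using cond_mono[of "{..j}" t "\<lambda>_. 0" "Z j"] Z_nonneg by (force simp: cond_const)

lemma y_nonneg: "t \<in> set_pmf (Pi_pmf {..<n} d D) \<Longrightarrow> 0 \<le> y t"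
  unfolding y_def using A_nonneg B_nonneg by (intro sum_nonneg) (simp add: add_nonneg_nonneg)

lemma q_nonneg: "0 \<le> q"
  unfolding q_def using E_mono[of "\<lambda>_. 0" "\<lambda>t. \<Sum>j<n. Z j t", OF sum_nonneg] Z_nonneg
  by simp

lemma q_le_1: "q \<le> 1"
  unfolding q_def using E_mono[of "\<lambda>t. \<Sum>j<n. Z j t" "\<lambda>_. 1"] Z_sum_le_1 by simp

lemma q_eq: "q = (\<Sum>j<n. E (Z j))"
  by (simp add: q_def E_sum)

lemma E_y: "E y = q"
proof -
  have "E (\<lambda>t. (A j t + B j t) / 2) = E (Z j)" if "j < n" for j
    using that E_cond[of "{j}" "Z j"] E_cond[of "{..j}" "Z j"] by (simp add: E_add subset_iff)
  then show ?thesis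
    by (simp add: y_def[abs_def] E_sum q_eq)
qed

lemma later_mass_le:
  assumes "i < n" "\<And>t. t \<in> set_pmf (Pi_pmf {..<n} d D) \<Longrightarrow> 0 \<le> G t"
  shows "(\<Sum>j\<in>{i<..<n}. E (\<lambda>t. G t * Z j t)) \<le> E G - E (\<lambda>t. G t * Z i t)"
proof -
  have "(\<Sum>j\<in>{i<..<n}. E (\<lambda>t. G t * Z j t)) = E (\<lambda>t. G t * (\<Sum>j\<in>{i<..<n}. Z j t))"
    by (simp add: E_sum sum_distrib_left)
  also have "\<dots> \<le> E (\<lambda>t. G t - G t * Z i t)"
  proof (rule E_mono)
    fix t assume t: "t \<in> set_pmf (Pi_pmf {..<n} d D)"
    have "Z i t + (\<Sum>j\<in>{i<..<n}. Z j t) = (\<Sum>j\<in>insert i {i<..<n}. Z j t)"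
      by simp
    also have "\<dots> \<le> (\<Sum>j<n. Z j t)"
      using \<open>i < n\<close> Z_nonneg[OF t] by (intro sum_mono2) auto
    also have "\<dots> \<le> 1"
      by (rule Z_sum_le_1[OF t])
    finally have "(\<Sum>j\<in>{i<..<n}. Z j t) \<le> 1 - Z i t"
      by simp
    then have "G t * (\<Sum>j\<in>{i<..<n}. Z j t) \<le> G t * (1 - Z i t)"
      by (rule mult_left_mono[OF _ assms(2)[OF t]])
    then show "G t * (\<Sum>j\<in>{i<..<n}. Z j t) \<le> G t - G t * Z i t"
      by (simp add: algebra_simps)
  qed
  finally show ?thesis
    by (simp add: E_diff)
qed

text \<open>In \<open>4 E[y^2]\<close> the diagonal contributes
  \<open>3 \<alpha> j + \<beta> j\<close>, and the bound on later mass subtracts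
  \<open>2 \<alpha> j + 2 \<beta> j\<close>. What remains beyond \<open>4 q + 2 q^2\<close> is the
  sum of \<open>\<alpha> j - \<beta> j\<close>, which is nonpositive.\<close>

lemma E_y_square_le: "E (\<lambda>t. (y t)\<^sup>2) \<le> q + q\<^sup>2 / 2"
proof -
  define a where "a j = E (Z j)" for j
  define \<alpha> where "\<alpha> j = E (\<lambda>t. A j t * A j t)" for j
  define \<beta> where "\<beta> j = E (\<lambda>t. B j t * B j t)" for j
  define S where "S j t = A j t + B j t" for j t
  have EA: "E (A j) = a j" and EB: "E (B j) = a j" if "j < n" for j
    using that E_cond[of "{j}" "Z j"] E_cond[of "{..j}" "Z j"] by (simp_all add: a_def subset_iff)
  have AZ: "E (\<lambda>t. A j t * Z j t) = \<alpha> j" and BZ: "E (\<lambda>t. B j t * Z j t) = \<beta> j" if "j < n" for j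
    using that E_mult_cond[OF _ depends_on_cond, of "{j}" "Z j" "Z j"]
      E_mult_cond[OF _ depends_on_cond, of "{..j}" "Z j" "Z j"]
    by (simp_all add: \<alpha>_def \<beta>_def subset_iff)
  \<comment> \<open>\<open>A j\<close> is a function of \<open>t j\<close> alone, hence known at
    time \<open>j\<close>, so \<open>B j\<close> may be replaced by \<open>Z j\<close>.\<close>
  have AB: "E (\<lambda>t. A j t * B j t) = \<alpha> j" if "j < n" for j
    using that AZ[OF that] E_mult_cond[OF _ depends_on_mono[OF depends_on_cond], of "{..j}" "{j}" "Z j" "Z j"]
    by (simp add: subset_iff)
  have diag: "E (\<lambda>t. (S j t)\<^sup>2) = 3 * \<alpha> j + \<beta> j" if "j < n" for j
    using AB[OF that] by (simp add: S_def power2_eq_square algebra_simps E_add \<alpha>_def \<beta>_def)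
  have off: "E (\<lambda>t. S i t * S j t) = 2 * (a i * a j) + E (\<lambda>t. A i t * Z j t) + E (\<lambda>t. B i t * Z j t)"
    if "i < j" "j < n" for i j
  proof -
    have "E (\<lambda>t. A i t * A j t) = a i * a j"
      using that EA[of i] EA[of j] E_mult_indep[OF _ _ _ depends_on_cond depends_on_cond, of "{i}" "{j}" "Z i" "Z j"]
      by simp
    moreover have "E (\<lambda>t. B i t * A j t) = a i * a j"
      using that EB[of i] EA[of j] E_mult_indep[OF _ _ _ depends_on_cond depends_on_cond, of "{..i}" "{j}" "Z i" "Z j"]
      by (simp add: subset_iff)
    moreover have "E (\<lambda>t. A i t * B j t) = E (\<lambda>t. A i t * Z j t)"
      using that by (intro E_mult_cond[symmetric] depends_on_mono[OF depends_on_cond]) auto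
    moreover have "E (\<lambda>t. B i t * B j t) = E (\<lambda>t. B i t * Z j t)"
      using that by (intro E_mult_cond[symmetric] depends_on_mono[OF depends_on_cond]) auto
    ultimately show ?thesis
      by (simp add: S_def algebra_simps E_add)
  qed
  \<comment> \<open>Conditioning on less information lowers the second moment; the difference is
    \<open>E[(B j - A j)^2]\<close>.\<close>
  have \<alpha>_le_\<beta>: "\<alpha> j \<le> \<beta> j" if "j < n" for j
  proof -
    have "0 \<le> E (\<lambda>t. (B j t - A j t)\<^sup>2)"
      by simp
    also have "\<dots> = \<beta> j - \<alpha> j"
      using AB[OF that] by (simp add: power2_eq_square algebra_simps E_add E_diff \<alpha>_def \<beta>_def)
    finally show ?thesis
      by simp
  qed
  \<comment> \<open>The double sum equals \<open>q^2\<close> minus the squares of the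
    \<open>a j\<close>, which are dropped.\<close>
  have cross: "(\<Sum>j<n. \<Sum>i<j. 2 * (a i * a j)) \<le> q\<^sup>2"
    using square_sum_lessThan[of a n] by (simp add: q_eq a_def[symmetric] sum_distrib_left sum_nonneg)
  \<comment> \<open>Pairs are regrouped by their earlier index \<open>i\<close>, so that
    \<open>later_mass_le\<close> bounds each inner sum.\<close>
  have later: "(\<Sum>j<n. \<Sum>i<j. E (\<lambda>t. A i t * Z j t) + E (\<lambda>t. B i t * Z j t)) \<le> (\<Sum>j<n. 2 * a j - \<alpha> j - \<beta> j)"
    unfolding sum_lessThan_triangle_swap
  proof (rule sum_mono)
    fix i assume "i \<in> {..<n}"
    then have i: "i < n" by simp
    show "(\<Sum>j\<in>{i<..<n}. E (\<lambda>t. A i t * Z j t) + E (\<lambda>t. B i t * Z j t)) \<le> 2 * a i - \<alpha> i - \<beta> i"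
      using later_mass_le[OF i, of "A i"] A_nonneg later_mass_le[OF i, of "B i"] B_nonneg i EA[OF i] EB[OF i] AZ[OF i] BZ[OF i]
      by (simp add: sum.distrib)
  qed
  have "4 * E (\<lambda>t. (y t)\<^sup>2) = E (\<lambda>t. (\<Sum>j<n. S j t)\<^sup>2)"
    by (simp add: y_def S_def sum_divide_distrib[symmetric] power_divide)
  also have "\<dots> = (\<Sum>j<n. E (\<lambda>t. (S j t)\<^sup>2)) + 2 * (\<Sum>j<n. \<Sum>i<j. E (\<lambda>t. S i t * S j t))"
    by (simp add: square_sum_lessThan E_add E_sum)
  also have "\<dots> = (\<Sum>j<n. 3 * \<alpha> j + \<beta> j) + 2 * (\<Sum>j<n. \<Sum>i<j. 2 * (a i * a j))
      + 2 * (\<Sum>j<n. \<Sum>i<j. E (\<lambda>t. A i t * Z j t) + E (\<lambda>t. B i t * Z j t))"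
    by (simp add: diag off sum.distrib)
  also have "\<dots> \<le> (\<Sum>j<n. 3 * \<alpha> j + \<beta> j) + 2 * q\<^sup>2 + 2 * (\<Sum>j<n. 2 * a j - \<alpha> j - \<beta> j)"
    using cross later by linarith
  also have "\<dots> = 4 * q + 2 * q\<^sup>2 + (\<Sum>j<n. \<alpha> j - \<beta> j)"
    by (simp add: q_eq a_def sum.distrib sum_subtractf sum_distrib_left[symmetric] sum_distrib_right[symmetric] algebra_simps)
  also have "\<dots> \<le> 4 * q + 2 * q\<^sup>2"
    using sum_nonpos[of "{..<n}" "\<lambda>j. \<alpha> j - \<beta> j"] \<alpha>_le_\<beta> by simp
  finally show ?thesis
    by simp
qed

text \<open>The mean of \<open>y\<close> is known exactly but its second moment only from above, so
  the minorants have to be concave.\<close>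

lemma E_quadratic_ge:
  assumes "\<And>x. 0 \<le> x \<Longrightarrow> a * x - b * x\<^sup>2 - c \<le> f x" "0 \<le> b"
  shows "a * q - b * (q + q\<^sup>2 / 2) - c \<le> E (\<lambda>t. f (y t))"
proof -
  have "a * q - b * (q + q\<^sup>2 / 2) - c \<le> a * E y - b * E (\<lambda>t. (y t)\<^sup>2) - c"
    using mult_left_mono[OF E_y_square_le \<open>0 \<le> b\<close>] by (simp add: E_y)
  also have "\<dots> = E (\<lambda>t. a * y t - b * (y t)\<^sup>2 - c)"
    by (simp add: E_diff)
  also have "\<dots> \<le> E (\<lambda>t. f (y t))"
    using assms(1) y_nonneg by (intro E_mono) auto
  finally show ?thesis .
qed

end

section \<open>The two ratios for a single offline vertex\<close>

context offline_statistics
begin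

lemma E_min_ge: "0.646 * q \<le> E (\<lambda>t. min (y t) 1)"
proof -
  \<comment> \<open>\<open>min x 1 = (x + 1 - \<bar>x - 1\<bar>) / 2\<close>, and AM-GM with parameter \<open>R\<close> bounds \<open>\<bar>x - 1\<bar>\<close>.  The value of \<open>R\<close>
    is read off the target \<open>(1 + q - R) / 2 = 0.646 q\<close>; what remains is \<open>E[(y - 1)\<^sup>2] \<le> R\<^sup>2\<close>.\<close>
  define R where "R = 1 - 0.292 * q"
  have R: "0 < R"
    using q_le_1 by (simp add: R_def)
  have min: "(1/2 + 1 / (2 * R)) * x - 1 / (4 * R) * x\<^sup>2 - (1 / (4 * R) + R / 4 - 1/2) \<le> min x 1" for x
  proof -
    have "2 * \<bar>x - 1\<bar> * R \<le> (x - 1)\<^sup>2 + R\<^sup>2"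
      using sum_squares_bound[of "\<bar>x - 1\<bar>" R] by simp
    then have "2 * \<bar>x - 1\<bar> \<le> ((x - 1)\<^sup>2 + R\<^sup>2) / R"
      using R by (simp add: pos_le_divide_eq)
    moreover have "(x + 1) / 2 - v / 4 \<le> min x 1" if "2 * \<bar>x - 1\<bar> \<le> v" for v
      using that by (cases "x \<le> 1") (auto simp: field_simps)
    ultimately have "(x + 1) / 2 - ((x - 1)\<^sup>2 + R\<^sup>2) / R / 4 \<le> min x 1"
      by blast
    moreover have "(x + 1) / 2 - ((x - 1)\<^sup>2 + R\<^sup>2) / R / 4
      = (1/2 + 1 / (2 * R)) * x - 1 / (4 * R) * x\<^sup>2 - (1 / (4 * R) + R / 4 - 1/2)"
      using R by (simp add: field_simps power2_eq_square)
    ultimately show ?thesis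
      by (simp only:)
  qed
  \<comment> \<open>Expanded, the bound against \<open>R^2\<close> reads
    \<open>0.414736 q^2 \<le> 0.416 q\<close>. The limit of this argument, attained at
    \<open>q = 1\<close>, is \<open>1 - sqrt 2 / 4\<close>, just above \<open>0.646\<close>.\<close>
  have "q\<^sup>2 \<le> q"
    using q_nonneg q_le_1 by (simp add: power2_eq_square mult_left_le)
  then have "1 - q + q\<^sup>2 / 2 \<le> R\<^sup>2"
    using q_nonneg by (simp add: R_def power2_eq_square algebra_simps)
  then have "(1 - q + q\<^sup>2 / 2) / R \<le> R"
    using R by (simp add: pos_divide_le_eq power2_eq_square)
  have "0.646 * q = (1 + q) / 2 - (R + R) / 4"
    by (simp add: R_def field_simps)
  also have "\<dots> \<le> (1 + q) / 2 - ((1 - q + q\<^sup>2 / 2) / R + R) / 4"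
    by (intro diff_left_mono divide_right_mono add_right_mono \<open>_ / R \<le> R\<close>) simp
  also have "\<dots> = (1/2 + 1 / (2 * R)) * q - 1 / (4 * R) * (q + q\<^sup>2 / 2) - (1 / (4 * R) + R / 4 - 1/2)"
    using R by (simp add: field_simps)
  also have "\<dots> \<le> E (\<lambda>t. min (y t) 1)"
    using R by (intro E_quadratic_ge min) auto
  finally show ?thesis .
qed

text \<open>Near \<open>q = 0\<close> the target is linear in \<open>q\<close> and tolerates no
  constant loss, hence the separate minorant up to \<open>q = 1/5\<close>, which yields
  \<open>0.637 q\<close>.\<close>

lemma E_ocs_bound_ge: "0.634 * q \<le> E (\<lambda>t. ocs_bound (y t))"
proof (cases "q \<le> 1/5")
  case True
  have "q * q \<le> q * (1/5)"
    using True q_nonneg by (rule mult_left_mono)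
  then have "0.634 * q \<le> 1 * q - 0.33 * (q + q\<^sup>2 / 2) - 0"
    using q_nonneg by (simp add: power2_eq_square)
  also have "\<dots> \<le> E (\<lambda>t. ocs_bound (y t))"
    using ocs_bound_ge_quadratic_small by (intro E_quadratic_ge) auto
  finally show ?thesis .
next
  case False
  \<comment> \<open>The product is the surplus over \<open>0.634 q\<close>. It vanishes at
    \<open>q = 1\<close>, where \<open>1.115 - 3/2 * 0.312 - 0.013\<close> is exactly
    \<open>0.634\<close>, and at \<open>q = 1/12\<close>.\<close>
  have "0 \<le> (1 - q) * (0.156 * q - 0.013)"
    using False q_le_1 by (intro mult_nonneg_nonneg) auto
  also have "\<dots> = 169 / 1000 * q - 156 / 1000 * q\<^sup>2 - 13 / 1000"
    by (simp add: power2_eq_square field_simps)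
  finally have "0.634 * q \<le> 1.115 * q - 0.312 * (q + q\<^sup>2 / 2) - 0.013"
    by (simp add: field_simps)
  also have "\<dots> \<le> E (\<lambda>t. ocs_bound (y t))"
    using ocs_bound_ge_quadratic by (intro E_quadratic_ge) auto
  finally show ?thesis .
qed

end

section \<open>Expected weight as a sum over offline vertices\<close>

lemma sum_prob_disjoint:
  assumes "finite X"
    and "\<And>M x x'. M \<in> set_pmf \<mu> \<Longrightarrow> x \<in> X \<Longrightarrow> x' \<in> X \<Longrightarrow> P x M \<Longrightarrow> P x' M \<Longrightarrow> x = x'"
  shows "(\<Sum>x\<in>X. measure_pmf.prob \<mu> {M. P x M}) = measure_pmf.prob \<mu> {M. \<exists>x\<in>X. P x M}"
proof -
  \<comment> \<open>The events are known to be disjoint only on the support of \<open>\<mu>\<close>,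
    so they are first intersected with it.\<close>
  have "(\<Sum>x\<in>X. measure_pmf.prob \<mu> {M. P x M}) = (\<Sum>x\<in>X. measure_pmf.prob \<mu> ({M. P x M} \<inter> set_pmf \<mu>))"
    by (simp add: measure_Int_set_pmf)
  also have "\<dots> = measure_pmf.prob \<mu> (\<Union>x\<in>X. {M. P x M} \<inter> set_pmf \<mu>)"
    using assms by (intro measure_pmf.finite_measure_finite_Union[symmetric])
      (auto simp: disjoint_family_on_def)
  also have "(\<Union>x\<in>X. {M. P x M} \<inter> set_pmf \<mu>) = {M. \<exists>x\<in>X. P x M} \<inter> set_pmf \<mu>"
    by auto
  finally show ?thesis
    by (simp add: measure_Int_set_pmf)
qed

lemma inj_on_fst_unique: "inj_on fst M \<Longrightarrow> (u, j) \<in> M \<Longrightarrow> (u, j') \<in> M \<Longrightarrow> j = j'"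
  by (metis fst_conv inj_onD prod.inject)

lemma inj_on_snd_unique: "inj_on snd M \<Longrightarrow> (u, j) \<in> M \<Longrightarrow> (u', j) \<in> M \<Longrightarrow> u = u'"
  by (metis snd_conv inj_onD prod.inject)

lemma prob_eq_0:
  assumes "\<And>M. M \<in> set_pmf \<mu> \<Longrightarrow> M \<notin> S"
  shows "measure_pmf.prob \<mu> S = 0"
  using assms by (auto simp: measure_pmf_zero_iff)

text \<open>Linearity of expectation reduces competitiveness to one inequality per offline vertex.
  It serves both \<open>opt\<close> and the rounded algorithm.\<close>

lemma expected_weight_eq:
  assumes I: "valid_instance I"
    and M: "\<And>t M. t \<in> set_pmf (types_pmf I) \<Longrightarrow> M \<in> set_pmf (rule I t) \<Longrightarrow>
      is_matching (edges I t) M"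
  shows "expected_weight rule I = (\<Sum>u\<in>offline I. weight I u *
    measure_pmf.expectation (types_pmf I) (\<lambda>t. measure_pmf.prob (rule I t) {M. u \<in> fst ` M}))"
proof -
  have fin: "finite (set_pmf (types_pmf I))"
    using I unfolding sample_types_def valid_instance_def by (intro finite_set_Pi_pmf) auto
  have sub: "M \<subseteq> offline I \<times> {..<arrivals I}"
    if "t \<in> set_pmf (types_pmf I)" "M \<in> set_pmf (rule I t)" for t M
    using M[OF that] that(1) I
    by (force simp: is_matching_def edges_def valid_instance_def sample_types_def set_Pi_pmf PiE_dflt_def)
  have fin_rule: "finite (set_pmf (rule I t))" if "t \<in> set_pmf (types_pmf I)" for t
    by (rule finite_subset[of _ "Pow (offline I \<times> {..<arrivals I})"])
       (use sub[OF that] I in \<open>auto simp: valid_instance_def\<close>)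
  have inner: "measure_pmf.expectation (rule I t) (matching_weight I) =
      (\<Sum>u\<in>offline I. weight I u * measure_pmf.prob (rule I t) {M. u \<in> fst ` M})"
    if t: "t \<in> set_pmf (types_pmf I)" for t
  proof -
    have "measure_pmf.expectation (rule I t) (matching_weight I) =
      measure_pmf.expectation (rule I t) (\<lambda>M. \<Sum>u\<in>offline I. weight I u * indicator {M. u \<in> fst ` M} M)"
    proof (rule expectation_cong_pmf)
      fix M assume "M \<in> set_pmf (rule I t)"
      from sub[OF t this] have "fst ` M = offline I \<inter> fst ` M"
        by auto
      then have "matching_weight I M = (\<Sum>u\<in>offline I \<inter> fst ` M. weight I u)"
        unfolding matching_weight_def by simp
      also have "\<dots> = (\<Sum>u\<in>offline I. if u \<in> fst ` M then weight I u else 0)"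
        using I by (intro sum.inter_restrict) (simp add: valid_instance_def)
      also have "\<dots> = (\<Sum>u\<in>offline I. weight I u * indicator {M. u \<in> fst ` M} M)"
        by (intro sum.cong) (auto simp: indicator_def)
      finally show "matching_weight I M = \<dots>" .
    qed
    also have "\<dots> = (\<Sum>u\<in>offline I. measure_pmf.expectation (rule I t) (\<lambda>M. weight I u * indicator {M. u \<in> fst ` M} M))"
      by (intro Bochner_Integration.integral_sum integrable_measure_pmf_finite fin_rule[OF t])
    finally show ?thesis
      by simp
  qed
  have "expected_weight rule I = measure_pmf.expectation (types_pmf I)
      (\<lambda>t. measure_pmf.expectation (rule I t) (matching_weight I))"
    unfolding expected_weight_def by (intro expectation_bind_pmf_finite fin fin_rule)
  also have "\<dots> = measure_pmf.expectation (types_pmf I)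
      (\<lambda>t. \<Sum>u\<in>offline I. weight I u * measure_pmf.prob (rule I t) {M. u \<in> fst ` M})"
    by (intro expectation_cong_pmf inner)
  also have "\<dots> = (\<Sum>u\<in>offline I. measure_pmf.expectation (types_pmf I)
      (\<lambda>t. weight I u * measure_pmf.prob (rule I t) {M. u \<in> fst ` M}))"
    by (intro Bochner_Integration.integral_sum integrable_measure_pmf_finite fin)
  finally show ?thesis
    by simp
qed

section \<open>Greedy matchings and selection histories\<close>

lemma greedy_matching_nth: "(u, i) \<in> greedy_matching h j \<Longrightarrow> i < j \<and> h ! i = Some u"
  by (induction j) (auto split: option.splits if_splits simp: less_Suc_eq)

lemma inj_on_fst_greedy_matching: "inj_on fst (greedy_matching h j)"
  by (induction j) (auto split: option.splits)

lemma inj_on_snd_greedy_matching: "inj_on snd (greedy_matching h j)"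
  by (force intro!: inj_onI dest: greedy_matching_nth)

text \<open>The first selection of a vertex finds it unmatched, and repeated selections change
  nothing.\<close>

lemma fst_greedy_matching: "fst ` greedy_matching h j = {u. \<exists>i<j. h ! i = Some u}"
  by (induction j) (auto split: option.splits simp: less_Suc_eq)

lemma greedy_matching_restrict:
  "j < n \<Longrightarrow> {e \<in> greedy_matching h n. snd e \<le> j} = greedy_matching h (Suc j)"
proof (induction n)
  case (Suc n)
  show ?case
  proof (cases "j = n")
    case True
    have "snd e \<le> n" if "e \<in> greedy_matching h (Suc n)" for e
      using greedy_matching_nth[of "fst e" "snd e" h "Suc n"] that by simp
    with True show ?thesis
      by (auto simp del: greedy_matching.simps)
  next
    case False
    then have "{e \<in> greedy_matching h (Suc n). snd e \<le> j} = {e \<in> greedy_matching h n. snd e \<le> j}"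
      using Suc.prems by (auto split: option.splits if_splits)
    with False Suc show ?thesis
      by simp
  qed
qed simp

lemma greedy_matching_take: "j \<le> m \<Longrightarrow> greedy_matching (take m h) j = greedy_matching h j"
  by (induction j) (auto split: option.splits)

lemma length_run_selector: "h \<in> set_pmf (run_selector sel L x n) \<Longrightarrow> length h = n"
  by (induction n arbitrary: h) auto

text \<open>Later rounds only append to the history, so truncating forgets them. Together with
  \<open>run_selector_cong\<close> this makes the rounding online.\<close>

lemma take_run_selector:
  "m \<le> n \<Longrightarrow> map_pmf (take m) (run_selector sel L x n) = run_selector sel L x m"
proof (induction n)
  case (Suc n)
  show ?case
  proof (cases "m = Suc n")
    case True
    have "map_pmf (take m) (run_selector sel L x m) = map_pmf id (run_selector sel L x m)"
      by (intro map_pmf_cong refl) (auto dest: length_run_selector)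
    with True show ?thesis
      by (simp del: run_selector.simps)
  next
    case False
    with Suc.prems have m: "m \<le> n"
      by simp
    have "map_pmf (take m) (run_selector sel L x (Suc n)) =
        bind_pmf (run_selector sel L x n) (\<lambda>h. map_pmf (\<lambda>a. take m (h @ [a])) (sel L (map x [0..<Suc n]) h))"
      by (simp add: map_bind_pmf map_pmf_comp o_def del: upt_Suc)
    also have "\<dots> = bind_pmf (run_selector sel L x n) (\<lambda>h. return_pmf (take m h))"
      using m by (intro bind_pmf_cong refl) (auto dest!: length_run_selector)
    finally show ?thesis
      using Suc.IH[OF m] by (simp add: map_pmf_def)
  qed
qed simp

lemma run_selector_cong:
  "(\<And>i. i < m \<Longrightarrow> x i = x' i) \<Longrightarrow> run_selector sel L x m = run_selector sel L x' m"
proof (induction m)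
  case (Suc m)
  then have "map x [0..<Suc m] = map x' [0..<Suc m]"
    by (intro map_cong) auto
  moreover have "run_selector sel L x m = run_selector sel L x' m"
    using Suc by simp
  ultimately show ?case
    by (simp only: run_selector.simps)
qed simp

section \<open>The fractional algorithm on a fixed instance\<close>

context
  fixes opt :: "('u, 't) matching_rule" and I :: "('u, 't) arrival_instance"
  assumes opt: "optimal_rule opt" and I: "valid_instance I"
begin

private abbreviation n :: nat where "n \<equiv> arrivals I"

definition Z :: "'u \<Rightarrow> nat \<Rightarrow> (nat \<Rightarrow> 't) \<Rightarrow> real" where
  "Z u j t = measure_pmf.prob (opt I t) {M. (u, j) \<in> M}"

lemma opt_matching:
  "t \<in> set_pmf (types_pmf I) \<Longrightarrow> M \<in> set_pmf (opt I t) \<Longrightarrow> is_matching (edges I t) M"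
  using opt I by (auto simp: optimal_rule_def is_max_weight_matching_def)

lemma finite_product_types: "finite_product {..<n} (type_dist I)"
  using I by unfold_locales (auto simp: valid_instance_def)

lemma offline_statistics_Z: "offline_statistics n undefined (type_dist I) (Z u)"
proof -
  interpret finite_product "{..<n}" undefined "type_dist I"
    by (rule finite_product_types)
  show ?thesis
  proof
    fix t
    assume "t \<in> set_pmf (Pi_pmf {..<n} undefined (type_dist I))"
    then have "inj_on fst M" if "M \<in> set_pmf (opt I t)" for M
      using opt_matching[of t M] that by (auto simp: sample_types_def is_matching_def)
    then have "(\<Sum>j<n. Z u j t) = measure_pmf.prob (opt I t) {M. \<exists>j\<in>{..<n}. (u, j) \<in> M}"
      unfolding Z_def by (intro sum_prob_disjoint) (auto dest: inj_on_fst_unique)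
    then show "(\<Sum>j<n. Z u j t) \<le> 1"
      by simp
  qed (simp add: Z_def)
qed

lemma sum_Z:
  assumes "t \<in> set_pmf (types_pmf I)"
  shows "(\<Sum>j<n. Z u j t) = measure_pmf.prob (opt I t) {M. u \<in> fst ` M}"
proof -
  have M: "inj_on fst M" "M \<subseteq> edges I t" if "M \<in> set_pmf (opt I t)" for M
    using opt_matching[OF assms that] by (auto simp: is_matching_def)
  then have "(\<Sum>j<n. Z u j t) = measure_pmf.prob (opt I t) {M. \<exists>j\<in>{..<n}. (u, j) \<in> M}"
    unfolding Z_def by (intro sum_prob_disjoint) (auto dest: inj_on_fst_unique)
  also have "\<dots> = measure_pmf.prob (opt I t) {M. u \<in> fst ` M}"
    using M(2) by (intro measure_pmf.finite_measure_eq_AE)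
      (force simp: AE_measure_pmf_iff edges_def)+
  finally show ?thesis .
qed

text \<open>The law of the optimal matching when \<open>t\<close> is kept on \<open>A\<close> and
  all other types are redrawn. The sets \<open>{j}\<close> and \<open>{..j}\<close> give the two
  halves of \<open>opt_frac\<close>.\<close>

definition resampled :: "nat set \<Rightarrow> (nat \<Rightarrow> 't) \<Rightarrow> ('u \<times> nat) set pmf" where
  "resampled A t = bind_pmf (sample_types I ({..<n} - A)) (\<lambda>s. opt I (\<lambda>i. if i \<in> A then t i else s i))"

text \<open>The merged type vector is again in the support and, since \<open>j \<in> A\<close>,
  agrees with \<open>t\<close> at \<open>j\<close>; edges at \<open>j\<close> are therefore edges of
  the actual graph.\<close>

lemma resampled_matching:
  assumes "t \<in> set_pmf (types_pmf I)" "A \<subseteq> {..<n}" "j \<in> A" "M \<in> set_pmf (resampled A t)"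
  shows "inj_on snd M" "(u, j) \<in> M \<Longrightarrow> u \<in> nbrs I (t j)"
proof -
  interpret finite_product "{..<n}" undefined "type_dist I"
    by (rule finite_product_types)
  obtain s where s: "s \<in> set_pmf (sample_types I ({..<n} - A))"
    and M: "M \<in> set_pmf (opt I (\<lambda>i. if i \<in> A then t i else s i))"
    using assms(4) by (auto simp: resampled_def)
  have "is_matching (edges I (\<lambda>i. if i \<in> A then t i else s i)) M"
    using merge_in_support[OF assms(2)] s assms(1)
    by (intro opt_matching[OF _ M]) (auto simp: sample_types_def)
  then show "inj_on snd M" "(u, j) \<in> M \<Longrightarrow> u \<in> nbrs I (t j)"
    using \<open>j \<in> A\<close> by (auto simp: is_matching_def edges_def)
qed

lemma opt_frac_eq:
  assumes "j < n"
  shows "opt_frac opt I t j u =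
    (measure_pmf.prob (resampled {j} t) {M. (u, j) \<in> M} + measure_pmf.prob (resampled {..j} t) {M. (u, j) \<in> M}) / 2"
proof -
  have "s(j := t j) = (\<lambda>i. if i \<in> {j} then t i else s i)" for s
    by auto
  moreover have "{j<..<n} = {..<n} - {..j}"
    by auto
  ultimately show ?thesis
    by (simp add: opt_frac_def resampled_def)
qed

lemma sum_resampled_le:
  assumes "t \<in> set_pmf (types_pmf I)" "A \<subseteq> {..<n}" "j \<in> A"
  shows "(\<Sum>u\<in>offline I. measure_pmf.prob (resampled A t) {M. (u, j) \<in> M}) \<le> 1"
proof -
  have "(\<Sum>u\<in>offline I. measure_pmf.prob (resampled A t) {M. (u, j) \<in> M})
      = measure_pmf.prob (resampled A t) {M. \<exists>u\<in>offline I. (u, j) \<in> M}"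
    using I resampled_matching(1)[OF assms]
    by (intro sum_prob_disjoint) (auto simp: valid_instance_def dest: inj_on_snd_unique)
  then show ?thesis
    by simp
qed

lemma prob_resampled_eq_0:
  assumes "t \<in> set_pmf (types_pmf I)" "A \<subseteq> {..<n}" "j \<in> A" "u \<notin> nbrs I (t j)"
  shows "measure_pmf.prob (resampled A t) {M. (u, j) \<in> M} = 0"
  using resampled_matching(2)[OF assms(1-3)] assms(4) by (intro prob_eq_0) auto

lemma opt_frac_selection:
  assumes t: "t \<in> set_pmf (types_pmf I)" and j: "j < n"
  shows "0 \<le> opt_frac opt I t j u" "opt_frac opt I t j u \<le> 1"
    and "0 < opt_frac opt I t j u \<Longrightarrow> u \<in> nbrs I (t j)"
    and "(\<Sum>u\<in>offline I. opt_frac opt I t j u) \<le> 1"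
proof -
  have sub: "{j} \<subseteq> {..<n}" "{..j} \<subseteq> {..<n}"
    using j by auto
  show "0 \<le> opt_frac opt I t j u"
    by (simp add: opt_frac_eq[OF j])
  have "measure_pmf.prob \<mu> S + measure_pmf.prob \<mu>' S \<le> 1 + 1" for \<mu> \<mu>' :: "('u \<times> nat) set pmf" and S
    by (intro add_mono measure_pmf.prob_le_1)
  then show "opt_frac opt I t j u \<le> 1"
    by (simp add: opt_frac_eq[OF j])
  show "u \<in> nbrs I (t j)" if "0 < opt_frac opt I t j u"
  proof (rule ccontr)
    assume "u \<notin> nbrs I (t j)"
    then have "opt_frac opt I t j u = 0"
      using prob_resampled_eq_0[OF t sub(1), of j u] prob_resampled_eq_0[OF t sub(2), of j u]
      by (simp add: opt_frac_eq[OF j])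
    with that show False
      by simp
  qed
  show "(\<Sum>u\<in>offline I. opt_frac opt I t j u) \<le> 1"
    using sum_resampled_le[OF t sub(1), of j] sum_resampled_le[OF t sub(2), of j]
    by (simp add: opt_frac_eq[OF j] sum_divide_distrib[symmetric] sum.distrib)
qed

text \<open>Needed because \<open>selection_vector\<close> demands the value 0 off the ground
  set.\<close>

lemma opt_frac_outside:
  assumes "t \<in> set_pmf (types_pmf I)" "j < n" "u \<notin> offline I"
  shows "opt_frac opt I t j u = 0"
proof -
  have "nbrs I (t j) \<subseteq> offline I"
    using assms(1,2) I by (auto simp: valid_instance_def sample_types_def set_Pi_pmf PiE_dflt_def)
  then show ?thesis
    using opt_frac_selection(1,3)[OF assms(1,2), of u] assms(3) by fastforce
qed

lemma opt_frac_cong: "(\<And>i. i \<le> j \<Longrightarrow> t i = t' i) \<Longrightarrow> opt_frac opt I t j = opt_frac opt I t' j"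
proof
  fix u
  assume t: "\<And>i. i \<le> j \<Longrightarrow> t i = t' i"
  then have "(\<lambda>i. if i \<le> j then t i else s i) = (\<lambda>i. if i \<le> j then t' i else s i)" for s
    by auto
  then show "opt_frac opt I t j u = opt_frac opt I t' j u"
    using t[of j] by (simp add: opt_frac_def)
qed

lemma frac_online_opt_frac: "frac_online I (opt_frac opt I)"
  unfolding frac_online_def
proof (intro conjI ballI allI impI)
  fix t t' :: "nat \<Rightarrow> 't" and j u
  assume "\<forall>i\<le>j. t i = t' i"
  then show "opt_frac opt I t j u = opt_frac opt I t' j u"
    by (simp add: opt_frac_cong[of j t t'])
qed (use opt_frac_selection in auto)

text \<open>Averaging \<open>Z u j\<close> over fresh types is taking a probability under the
  mixture \<open>resampled\<close>, so \<open>A j\<close> and \<open>B j\<close> are twice the two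
  summands of \<open>opt_frac\<close>.\<close>

lemma y_eq: "offline_statistics.y n undefined (type_dist I) (Z u) t = (\<Sum>j<n. opt_frac opt I t j u)"
proof -
  interpret offline_statistics n undefined "type_dist I" "Z u"
    by (rule offline_statistics_Z)
  have "cond A (Z u j) t = measure_pmf.prob (resampled A t) {M. (u, j) \<in> M}" for A j
    using finite_support[of "{..<n} - A"]
    by (simp add: cond_def Z_def resampled_def measure_bind_pmf_finite sample_types_def)
  then show ?thesis
    by (simp add: y_def opt_frac_eq)
qed

lemma expected_weight_opt:
  "expected_weight opt I = (\<Sum>u\<in>offline I. weight I u * offline_statistics.q n undefined (type_dist I) (Z u))"
proof -
  have "measure_pmf.expectation (types_pmf I) (\<lambda>t. measure_pmf.prob (opt I t) {M. u \<in> fst ` M})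
      = offline_statistics.q n undefined (type_dist I) (Z u)" for u
  proof -
    interpret offline_statistics n undefined "type_dist I" "Z u"
      by (rule offline_statistics_Z)
    show ?thesis
      unfolding q_def using sum_Z[of _ u] by (auto simp: sample_types_def intro!: expectation_cong_pmf)
  qed
  then show ?thesis
    using expected_weight_eq[where rule = opt, OF I opt_matching] by simp
qed

lemma weighted_sum_ge:
  assumes "\<And>u. u \<in> offline I \<Longrightarrow> \<Gamma> * offline_statistics.q n undefined (type_dist I) (Z u) \<le> f u"
  shows "\<Gamma> * expected_weight opt I \<le> (\<Sum>u\<in>offline I. weight I u * f u)"
proof -
  have "\<Gamma> * expected_weight opt I
      = (\<Sum>u\<in>offline I. weight I u * (\<Gamma> * offline_statistics.q n undefined (type_dist I) (Z u)))"
    by (simp add: expected_weight_opt sum_distrib_left algebra_simps)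
  also have "\<dots> \<le> (\<Sum>u\<in>offline I. weight I u * f u)"
    using I assms by (intro sum_mono mult_left_mono) (auto simp: valid_instance_def)
  finally show ?thesis .
qed

lemma frac_value_opt_frac:
  "0.646 * expected_weight opt I
    \<le> measure_pmf.expectation (types_pmf I) (\<lambda>t. frac_value I (opt_frac opt I t))"
proof -
  interpret finite_product "{..<n}" undefined "type_dist I"
    by (rule finite_product_types)
  have "0.646 * expected_weight opt I
      \<le> (\<Sum>u\<in>offline I. weight I u * E (\<lambda>t. min (\<Sum>j<n. opt_frac opt I t j u) 1))"
    using offline_statistics.E_min_ge[OF offline_statistics_Z] by (intro weighted_sum_ge) (simp add: y_eq)
  then show ?thesis
    by (simp add: frac_value_def sample_types_def E_sum)
qed

section \<open>Rounding by online correlated selection\<close>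

context
  fixes ocs :: "'u selector"
  assumes ocs: "is_ocs ocs_bound ocs"
begin

abbreviation selections :: "(nat \<Rightarrow> 't) \<Rightarrow> 'u option list pmf" where
  "selections t \<equiv> run_selector ocs (offline I) (opt_frac opt I t) n"

text \<open>For fixed types the fractional vectors form a fixed sequence, so the guarantee applies
  to each \<open>t\<close> separately and can be averaged over \<open>t\<close> afterwards.\<close>

lemma selections_ocs:
  assumes "t \<in> set_pmf (types_pmf I)"
  shows "\<And>h j. h \<in> set_pmf (selections t) \<Longrightarrow> j < n \<Longrightarrow>
      0 < selection_mass (offline I) (opt_frac opt I t j) (h ! j)"
    and "\<And>u. u \<in> offline I \<Longrightarrow> ocs_bound (\<Sum>j<n. opt_frac opt I t j u)
      \<le> measure_pmf.prob (selections t) {h. Some u \<in> set h}"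
proof -
  have "selection_vector (offline I) (opt_frac opt I t j)" if "j < n" for j
    using opt_frac_selection[OF assms that] opt_frac_outside[OF assms that]
    by (simp add: selection_vector_def)
  with ocs I show "\<And>h j. h \<in> set_pmf (selections t) \<Longrightarrow> j < n \<Longrightarrow>
      0 < selection_mass (offline I) (opt_frac opt I t j) (h ! j)"
    and "\<And>u. u \<in> offline I \<Longrightarrow> ocs_bound (\<Sum>j<n. opt_frac opt I t j u)
      \<le> measure_pmf.prob (selections t) {h. Some u \<in> set h}"
    unfolding is_ocs_def valid_instance_def by blast+
qed

lemma ocs_rounding_matching:
  assumes "t \<in> set_pmf (types_pmf I)" "M \<in> set_pmf (ocs_rounding ocs (opt_frac opt) I t)"
  shows "is_matching (edges I t) M"
proof -
  obtain h where h: "h \<in> set_pmf (selections t)" and M: "M = greedy_matching h n"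
    using assms(2) by (auto simp: ocs_rounding_def)
  have "u \<in> nbrs I (t j)" if "j < n" "h ! j = Some u" for u j
    using selections_ocs(1)[OF assms(1) h that(1)] opt_frac_selection(3)[OF assms(1) that(1)] that(2)
    by (simp add: selection_mass_def)
  then show ?thesis
    unfolding is_matching_def M edges_def
    using inj_on_fst_greedy_matching inj_on_snd_greedy_matching by (auto dest: greedy_matching_nth)
qed

text \<open>Edges up to arrival \<open>j\<close> are determined by the first \<open>Suc j\<close>
  selections, whose law is that of the shorter run and involves no later fractional vector.\<close>

lemma ocs_rounding_prefix:
  assumes "j < n"
  shows "map_pmf (\<lambda>M. {e \<in> M. snd e \<le> j}) (ocs_rounding ocs (opt_frac opt) I t)
    = map_pmf (\<lambda>h. greedy_matching h (Suc j)) (run_selector ocs (offline I) (opt_frac opt I t) (Suc j))"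
proof -
  have "map_pmf (\<lambda>M. {e \<in> M. snd e \<le> j}) (ocs_rounding ocs (opt_frac opt) I t)
      = map_pmf (\<lambda>h. greedy_matching (take (Suc j) h) (Suc j)) (selections t)"
    by (simp add: ocs_rounding_def map_pmf_comp greedy_matching_restrict[OF assms] greedy_matching_take
        del: greedy_matching.simps)
  also have "\<dots> = map_pmf (\<lambda>h. greedy_matching h (Suc j)) (map_pmf (take (Suc j)) (selections t))"
    by (simp add: map_pmf_comp del: greedy_matching.simps)
  finally show ?thesis
    by (simp only: take_run_selector[OF Suc_leI[OF assms]])
qed

lemma integral_online_ocs_rounding: "integral_online I (ocs_rounding ocs (opt_frac opt) I)"
  unfolding integral_online_def
proof (intro conjI ballI allI impI)
  fix t t' :: "nat \<Rightarrow> 't" and j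
  assume "j < n" and t: "\<forall>i\<le>j. t i = t' i"
  have "opt_frac opt I t i = opt_frac opt I t' i" if "i < Suc j" for i
    using t that by (intro opt_frac_cong) auto
  then have "run_selector ocs (offline I) (opt_frac opt I t) (Suc j)
      = run_selector ocs (offline I) (opt_frac opt I t') (Suc j)"
    by (rule run_selector_cong)
  then show "map_pmf (\<lambda>M. {e \<in> M. snd e \<le> j}) (ocs_rounding ocs (opt_frac opt) I t)
      = map_pmf (\<lambda>M. {e \<in> M. snd e \<le> j}) (ocs_rounding ocs (opt_frac opt) I t')"
    by (simp only: ocs_rounding_prefix[OF \<open>j < n\<close>])
qed (rule ocs_rounding_matching)

lemma prob_ocs_rounding:
  "measure_pmf.prob (ocs_rounding ocs (opt_frac opt) I t) {M. u \<in> fst ` M}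
    = measure_pmf.prob (selections t) {h. Some u \<in> set h}"
proof -
  have "measure_pmf.prob (ocs_rounding ocs (opt_frac opt) I t) {M. u \<in> fst ` M}
      = measure_pmf.prob (selections t) {h. u \<in> fst ` greedy_matching h n}"
    by (simp add: ocs_rounding_def vimage_def)
  \<comment> \<open>Histories in the support have length exactly \<open>n\<close>, so membership in
    the list means selection in some round before \<open>n\<close>.\<close>
  also have "\<dots> = measure_pmf.prob (selections t) {h. Some u \<in> set h}"
    by (intro measure_pmf.finite_measure_eq_AE)
      (auto simp: AE_measure_pmf_iff fst_greedy_matching in_set_conv_nth length_run_selector)
  finally show ?thesis .
qed

lemma expected_weight_ocs_rounding:
  "0.634 * expected_weight opt I \<le> expected_weight (ocs_rounding ocs (opt_frac opt)) I"
proof -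
  interpret finite_product "{..<n}" undefined "type_dist I"
    by (rule finite_product_types)
  have vertex: "0.634 * offline_statistics.q n undefined (type_dist I) (Z u)
      \<le> E (\<lambda>t. measure_pmf.prob (ocs_rounding ocs (opt_frac opt) I t) {M. u \<in> fst ` M})"
    if "u \<in> offline I" for u
  proof -
    have "0.634 * offline_statistics.q n undefined (type_dist I) (Z u)
        \<le> E (\<lambda>t. ocs_bound (\<Sum>j<n. opt_frac opt I t j u))"
      using offline_statistics.E_ocs_bound_ge[OF offline_statistics_Z] by (simp add: y_eq)
    also have "\<dots> \<le> E (\<lambda>t. measure_pmf.prob (ocs_rounding ocs (opt_frac opt) I t) {M. u \<in> fst ` M})"
      using selections_ocs(2)[OF _ that] by (intro E_mono) (simp add: prob_ocs_rounding sample_types_def)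
    finally show ?thesis .
  qed
  have "0.634 * expected_weight opt I \<le> (\<Sum>u\<in>offline I. weight I u *
      E (\<lambda>t. measure_pmf.prob (ocs_rounding ocs (opt_frac opt) I t) {M. u \<in> fst ` M}))"
    by (rule weighted_sum_ge[OF vertex])
  also have "\<dots> = expected_weight (ocs_rounding ocs (opt_frac opt)) I"
    unfolding sample_types_def[symmetric]
    by (intro expected_weight_eq[symmetric] I ocs_rounding_matching)
  finally show ?thesis .
qed

end

end

theorem theorem2:
  fixes opt :: "('u, 't) matching_rule"
  assumes "optimal_rule opt"
  shows "frac_competitive opt 0.646 (opt_frac opt) \<and>
    (\<forall>ocs :: 'u selector. is_ocs ocs_bound ocs \<longrightarrow>
       integral_competitive opt 0.634 (ocs_rounding ocs (opt_frac opt)))"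
  using assms frac_online_opt_frac frac_value_opt_frac integral_online_ocs_rounding
    expected_weight_ocs_rounding
  by (auto simp: frac_competitive_def integral_competitive_def)

end
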